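(* Let $f:[a,b]\to\mathbb{R}$ be an absolutely continuous mapping and let $\alpha,\beta$ be non-negative real numbers. Let $\tau(x;\alpha,\beta)$ and $P(x,t)$ be as defined in the context, and let $$\kappa=\frac{f'(b)-f'(a)}{b-a}.$$ Then $$\begin{aligned}&\left|\tau(x;\alpha,\beta)-\frac{1}{\alpha+\beta}\left[\frac{\alpha}{x-a}\left\{\left[x-\left(a+h\tfrac{b-a}{2}\right)\right]^3+\left(h\tfrac{b-a}{2}\right)^3\right\}-\frac{\beta}{b-x}\left\{\left(h\tfrac{b-a}{2}\right)^3+\left[x-\left(b-h\tfrac{b-a}{2}\right)\right]^3\right\}\right]\frac{\kappa}{6}\right|\\&\quad\le (b-a)\,N(x)\left[\frac{1}{b-a}\|f''\|_2^2-\kappa^2\right]^{1/2}\\&\quad\le (b-a)(\Gamma-\gamma)\lambda,\end{aligned}$$ where $\gamma,\Gamma$ are constants with $\gamma\le f''(t)\le\Gamma$ for $t\in[a,b]$, where $\lambda=\Phi-\varphi$ with $\Phi=\sup_{t\in[a,b]}P(x,t)$ and $\varphi=\inf_{t\in[a,b]}P(x,t)$, and where $N(x)\ge 0$ is given by $$\begin{aligned}N^2(x)={}&\frac{1}{20(\alpha+\beta)^2}\Bigg\{\frac{\alpha^2}{(x-a)^2}\left[\left(x-\left(a+h\tfrac{b-a}{2}\right)\right)^5+\left(h\tfrac{b-a}{2}\right)^5\right]\\&\qquad+\frac{\beta^2}{(b-x)^2}\left[\left(h\tfrac{b-a}{2}\right)^5-\left(x-\left(b-h\tfrac{b-a}{2}\right)\right)^5\right]\Bigg\}\\&-\Bigg(\frac{1}{6(b-a)(\alpha+\beta)}\Bigg[\frac{\alpha}{x-a}\left\{\left[x-\left(a+h\tfrac{b-a}{2}\right)\right]^3+\left(h\tfrac{b-a}{2}\right)^3\right\}\\&\qquad-\frac{\beta}{b-x}\left\{\left(h\tfrac{b-a}{2}\right)^3+\left[x-\left(b-h\tfrac{b-a}{2}\right)\right]^3\right\}\Bigg]\Bigg)^2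 .\end{aligned}$$
   Context: Here $a<b$, $h\in[0,1]$, $x\in\left[a+h\frac{b-a}{2},\,b-h\frac{b-a}{2}\right]$, and $\alpha,\beta$ are not both zero. The functional $\tau$ is $$\begin{aligned}\tau(x;\alpha,\beta)={}&\frac{1}{2(\alpha+\beta)}\left[\frac{\alpha}{x-a}\left(x-\left(a+h\tfrac{b-a}{2}\right)\right)^2-\frac{\beta}{b-x}\left(x-\left(b-h\tfrac{b-a}{2}\right)\right)^2\right]f'(x)\\&-\frac{1}{\alpha+\beta}\left[\frac{\alpha}{x-a}\left(x-\left(a+h\tfrac{b-a}{2}\right)\right)-\frac{\beta}{b-x}\left(x-\left(b-h\tfrac{b-a}{2}\right)\right)\right]f(x)\\&-\frac{1}{\alpha+\beta}\,h\,\frac{b-a}{2}\left[\frac{\alpha}{x-a}f(a)+\frac{\beta}{b-x}f(b)\right]\\&+\frac{1}{\alpha+\beta}\,h^2\,\frac{(b-a)^2}{8}\left[\frac{\beta}{b-x}f'(b)-\frac{\alpha}{x-a}f'(a)\right]\\&+\frac{1}{\alpha+\beta}\left[\alpha M(f;a,x)+\beta M(f;x,b)\right],\end{aligned}$$ where $M(f;c,d)=\frac{1}{d-c}\int_c^d f(t)\,dt$ is the integral mean. The kernel $P$ is $$P(x,t)=\begin{cases}\dfrac{\alpha}{\alpha+\beta}\,\dfrac{1}{x-a}\,\dfrac12\left[t-\left(a+h\frac{b-a}{2}\right)\right]^2, & a\le t\le x,\\[2mm] \dfrac{\beta}{\alpha+\beta}\,\dfrac{1}{b-x}\,\dfrac12\left[t-\left(b-h\frac{b-a}{2}\right)\right]^2,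 & x<t\le b.\end{cases}$$ The norm is $\|f''\|_2=\left(\int_a^b|f''(t)|^2\,dt\right)^{1/2}$.
   Formalization: Corrected: in both cubic brackets the β-brace is [x-(b-h(b-a)/2)]^3 - (h(b-a)/2)^3 (printed with plus), and the first term of N^2 has an extra factor 1/(b-a). Also assumed: f' exists on [a,b] and is absolutely continuous, with f'' (a.e.) in L^2. *)

theory Defs
  imports "HOL-Analysis.Analysis"
begin

text \<open>
  Absolute continuity on a compact interval. A family D with \<open>D division_of \<Union>D\<close> is a
  finite family of compact intervals with pairwise disjoint interiors.
\<close>

definition abs_cont_on :: "(real \<Rightarrow> real) \<Rightarrow> real \<Rightarrow> real \<Rightarrow> bool" where
  "abs_cont_on f a b \<longleftrightarrow>
    (\<forall>\<epsilon>>0. \<exists>\<delta>>0. \<forall>D. D division_of \<Union>D \<and> \<Union>D \<subseteq> {a..b} \<and> (\<Sum>K\<in>D. Sup K - Inf K) < \<delta>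
       \<longrightarrow> (\<Sum>K\<in>D. \<bar>f (Sup K) - f (Inf K)\<bar>) < \<epsilon>)"

definition int_mean :: "(real \<Rightarrow> real) \<Rightarrow> real \<Rightarrow> real \<Rightarrow> real" where
  "int_mean f c d = 1 / (d - c) * integral {c..d} f"

definition norm2 :: "(real \<Rightarrow> real) \<Rightarrow> real \<Rightarrow> real \<Rightarrow> real" where
  "norm2 g a b = sqrt (integral {a..b} (\<lambda>t. \<bar>g t\<bar>\<^sup>2))"

text \<open>
  In the definitions below, f' stands for the derivative of f. For h = 0 the point x may
  coincide with a or b; the terms carrying a factor 1 / (x - a) or 1 / (b - x) are then 0,
  because division by zero yields 0. For a differentiable f this is also the limiting value
  of the respective group of terms.
\<close>

definition \<tau> :: "(real \<Rightarrow> real) \<Rightarrow> (real \<Rightarrow> real) \<Rightarrow> real \<Rightarrow> real \<Rightarrow> real \<Rightarrow> real \<Rightarrow> real \<Rightarrow> real \<Rightarrow> real" where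
  "\<tau> f f' a b h x \<alpha> \<beta> =
     1 / (2 * (\<alpha> + \<beta>)) *
       (\<alpha> / (x - a) * (x - (a + h * ((b - a) / 2)))\<^sup>2
        - \<beta> / (b - x) * (x - (b - h * ((b - a) / 2)))\<^sup>2) * f' x
     - 1 / (\<alpha> + \<beta>) *
       (\<alpha> / (x - a) * (x - (a + h * ((b - a) / 2)))
        - \<beta> / (b - x) * (x - (b - h * ((b - a) / 2)))) * f x
     - 1 / (\<alpha> + \<beta>) * h * ((b - a) / 2) *
       (\<alpha> / (x - a) * f a + \<beta> / (b - x) * f b)
     + 1 / (\<alpha> + \<beta>) * h\<^sup>2 * ((b - a)\<^sup>2 / 8) *
       (\<beta> / (b - x) * f' b - \<alpha> / (x - a) * f' a)
     + 1 / (\<alpha> + \<beta>) * (\<alpha> * int_mean f a x + \<beta> * int_mean f x b)"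

text \<open>The kernel is only evaluated at \<open>t \<in> {a..b}\<close>.\<close>

definition P :: "real \<Rightarrow> real \<Rightarrow> real \<Rightarrow> real \<Rightarrow> real \<Rightarrow> real \<Rightarrow> real \<Rightarrow> real" where
  "P a b h \<alpha> \<beta> x t =
     (if t \<le> x
      then \<alpha> / (\<alpha> + \<beta>) * (1 / (x - a)) * (1 / 2) * (t - (a + h * ((b - a) / 2)))\<^sup>2
      else \<beta> / (\<alpha> + \<beta>) * (1 / (b - x)) * (1 / 2) * (t - (b - h * ((b - a) / 2)))\<^sup>2)"

text \<open>
  The integral of \<open>P a b h \<alpha> \<beta> x\<close> over \<open>{a..b}\<close> equals \<open>1 / (6 * (\<alpha> + \<beta>))\<close> times the following
  bracket. The last brace comes from integrating \<open>(t - (b - h * (b - a) / 2))\<^sup>2\<close> over \<open>{x..b}\<close>,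
  so the power of \<open>h * (b - a) / 2\<close> in it carries a minus sign. (It is sometimes printed with
  a plus sign; the estimates below then fail, for example for \<open>f t = t\<^sup>2\<close> with h = 1 and
  \<open>\<beta> > 0\<close>.)
\<close>

definition cubic_bracket :: "real \<Rightarrow> real \<Rightarrow> real \<Rightarrow> real \<Rightarrow> real \<Rightarrow> real \<Rightarrow> real" where
  "cubic_bracket a b h x \<alpha> \<beta> =
     \<alpha> / (x - a) * ((x - (a + h * ((b - a) / 2))) ^ 3 + (h * ((b - a) / 2)) ^ 3)
     - \<beta> / (b - x) * ((x - (b - h * ((b - a) / 2))) ^ 3 - (h * ((b - a) / 2)) ^ 3)"

text \<open>
  The radicand is the mean of the square of \<open>P a b h \<alpha> \<beta> x\<close> over \<open>{a..b}\<close> minus the square of its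
  mean, hence nonnegative. Both means carry the normalising factor 1 / (b - a). (It is
  sometimes omitted in the first term; this is only correct for b - a = 1.)
\<close>

definition N :: "real \<Rightarrow> real \<Rightarrow> real \<Rightarrow> real \<Rightarrow> real \<Rightarrow> real \<Rightarrow> real" where
  "N a b h x \<alpha> \<beta> = sqrt (
     1 / (20 * (b - a) * (\<alpha> + \<beta>)\<^sup>2) *
       (\<alpha>\<^sup>2 / (x - a)\<^sup>2 * ((x - (a + h * ((b - a) / 2))) ^ 5 + (h * ((b - a) / 2)) ^ 5)
        + \<beta>\<^sup>2 / (b - x)\<^sup>2 * ((h * ((b - a) / 2)) ^ 5 - (x - (b - h * ((b - a) / 2))) ^ 5))
     - (1 / (6 * (b - a) * (\<alpha> + \<beta>)) * cubic_bracket a b h x \<alpha> \<beta>)\<^sup>2)"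

end

theory Submission
  imports Defs
begin

text \<open>
  Integrating by parts twice on \<open>{a..x}\<close> and on \<open>{x..b}\<close> shows that \<open>\<tau>\<close> is the integral of
  \<open>P a b h \<alpha> \<beta> x\<close> against f''. Subtracting \<open>\<kappa>\<close>, the mean of f'', times the integral of the kernel
  leaves b - a times the covariance of the kernel and f'' for the uniform distribution on \<open>{a..b}\<close>.
  The Cauchy-Schwarz inequality bounds it by the product of the standard deviations, \<open>N\<close> being that
  of the kernel, and each of these is at most half the oscillation of its function.
\<close>

section \<open>Absolute continuity: closure properties and continuity\<close>

lemma abs_cont_onD:
  assumes "abs_cont_on f a b" "\<epsilon> > 0"
  obtains \<delta> where "\<delta> > 0"
    "\<And>D. \<lbrakk>D division_of \<Union>D; \<Union>D \<subseteq> {a..b}; (\<Sum>K\<in>D. Sup K - Inf K) < \<delta>\<rbrakk>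
      \<Longrightarrow> (\<Sum>K\<in>D. \<bar>f (Sup K) - f (Inf K)\<bar>) < \<epsilon>"
  using assms unfolding abs_cont_on_def by meson

text \<open>Members of a division are nonempty compact intervals, so \<open>Inf K\<close> and
  \<open>Sup K\<close>, in which absolute continuity is phrased, are their endpoints.\<close>

lemma division_of_real_Sup_Inf:
  fixes D :: "real set set"
  assumes "D division_of S" "K \<in> D"
  shows "Inf K \<le> Sup K" "Inf K \<in> S" "Sup K \<in> S" "K = {Inf K..Sup K}"
proof -
  obtain u v where uv: "K = {u..v}" and "K \<noteq> {}" "K \<subseteq> S"
    using division_ofD(2,3,4)[OF assms] by (metis box_real(2))
  then have "u \<le> v" by auto
  then show "Inf K \<le> Sup K" "Inf K \<in> S" "Sup K \<in> S" "K = {Inf K..Sup K}"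
    using uv \<open>K \<subseteq> S\<close> by auto
qed

lemma abs_cont_on_subset:
  assumes "abs_cont_on f a b" "{c..d} \<subseteq> {a..b}"
  shows "abs_cont_on f c d"
  using assms unfolding abs_cont_on_def by (meson order_trans)

text \<open>The closure properties for constants, differences and products reduce to this: the
  increment bound is summed over a division short enough for both \<open>f\<close> and
  \<open>g\<close>.\<close>

lemma abs_cont_on_dominated:
  assumes f: "abs_cont_on f a b" and g: "abs_cont_on g a b" and C: "C \<ge> 0"
    and le: "\<And>u v. \<lbrakk>u \<in> {a..b}; v \<in> {a..b}\<rbrakk> \<Longrightarrow> \<bar>k v - k u\<bar> \<le> C * (\<bar>f v - f u\<bar> + \<bar>g v - g u\<bar>)"
  shows "abs_cont_on k a b"
  unfolding abs_cont_on_def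
proof (intro allI impI)
  fix \<epsilon> :: real assume "\<epsilon> > 0"
  \<comment> \<open>The factor 2 accounts for the two dominating functions; \<open>C + 1\<close> in
    place of \<open>C\<close> keeps \<open>M\<close> positive for \<open>C = 0\<close> and makes the
    final estimate strict.\<close>
  define M where "M = 2 * (C + 1)"
  define \<eta> where "\<eta> = \<epsilon> / M"
  have "M > 0" using C by (simp add: M_def)
  then have "\<eta> > 0" using \<open>\<epsilon> > 0\<close> by (simp add: \<eta>_def)
  obtain \<delta> where \<delta>: "\<delta> > 0"
    "\<And>D. \<lbrakk>D division_of \<Union>D; \<Union>D \<subseteq> {a..b}; (\<Sum>K\<in>D. Sup K - Inf K) < \<delta>\<rbrakk>
      \<Longrightarrow> (\<Sum>K\<in>D. \<bar>f (Sup K) - f (Inf K)\<bar>) < \<eta>"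
    by (rule abs_cont_onD[OF f \<open>\<eta> > 0\<close>]) (erule that, blast)
  obtain \<delta>' where \<delta>': "\<delta>' > 0"
    "\<And>D. \<lbrakk>D division_of \<Union>D; \<Union>D \<subseteq> {a..b}; (\<Sum>K\<in>D. Sup K - Inf K) < \<delta>'\<rbrakk>
      \<Longrightarrow> (\<Sum>K\<in>D. \<bar>g (Sup K) - g (Inf K)\<bar>) < \<eta>"
    by (rule abs_cont_onD[OF g \<open>\<eta> > 0\<close>]) (erule that, blast)
  show "\<exists>\<delta>>0. \<forall>D. D division_of \<Union>D \<and> \<Union>D \<subseteq> {a..b} \<and> (\<Sum>K\<in>D. Sup K - Inf K) < \<delta>
       \<longrightarrow> (\<Sum>K\<in>D. \<bar>k (Sup K) - k (Inf K)\<bar>) < \<epsilon>"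
  proof (intro exI[of _ "min \<delta> \<delta>'"] conjI allI impI)
    show "min \<delta> \<delta>' > 0" using \<delta>(1) \<delta>'(1) by simp
    fix D assume D: "D division_of \<Union>D \<and> \<Union>D \<subseteq> {a..b} \<and> (\<Sum>K\<in>D. Sup K - Inf K) < min \<delta> \<delta>'"
    have "(\<Sum>K\<in>D. \<bar>k (Sup K) - k (Inf K)\<bar>)
        \<le> (\<Sum>K\<in>D. C * (\<bar>f (Sup K) - f (Inf K)\<bar> + \<bar>g (Sup K) - g (Inf K)\<bar>))"
      using D division_of_real_Sup_Inf[of D "\<Union>D"] by (intro sum_mono le) blast+
    also have "\<dots> = C * ((\<Sum>K\<in>D. \<bar>f (Sup K) - f (Inf K)\<bar>) + (\<Sum>K\<in>D. \<bar>g (Sup K) - g (Inf K)\<bar>))"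
      by (simp add: sum.distrib flip: sum_distrib_left)
    also have "\<dots> \<le> C * (\<eta> + \<eta>)"
      using \<delta>(2)[of D] \<delta>'(2)[of D] D C by (intro mult_left_mono add_mono) auto
    also have "\<dots> < (C + 1) * (\<eta> + \<eta>)"
      using \<open>\<eta> > 0\<close> by simp
    also have "\<dots> = M * \<eta>"
      by (simp add: M_def algebra_simps)
    also have "\<dots> = \<epsilon>"
      using \<open>M > 0\<close> by (simp add: \<eta>_def)
    finally show "(\<Sum>K\<in>D. \<bar>k (Sup K) - k (Inf K)\<bar>) < \<epsilon>" .
  qed
qed

lemma abs_cont_on_ident: "abs_cont_on (\<lambda>t. t) a b"
  unfolding abs_cont_on_def
proof (intro allI impI)
  fix \<epsilon> :: real assume "\<epsilon> > 0"
  then show "\<exists>\<delta>>0. \<forall>D. D division_of \<Union>D \<and> \<Union>D \<subseteq> {a..b} \<and> (\<Sum>K\<in>D. Sup K - Inf K) < \<delta>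
       \<longrightarrow> (\<Sum>K\<in>D. \<bar>Sup K - Inf K\<bar>) < \<epsilon>"
    using division_of_real_Sup_Inf(1)
    by (intro exI[of _ \<epsilon>]) (auto simp: abs_of_nonneg cong: sum.cong)
qed

lemma abs_cont_on_const: "abs_cont_on (\<lambda>t. c) a b"
  \<comment> \<open>Increments of a constant vanish, so \<open>C = 0\<close> works with the identity
    as both dominating functions.\<close>
  by (rule abs_cont_on_dominated[OF abs_cont_on_ident abs_cont_on_ident, of 0]) auto

lemma abs_cont_on_diff:
  assumes "abs_cont_on f a b" "abs_cont_on g a b"
  shows "abs_cont_on (\<lambda>t. f t - g t) a b"
  by (rule abs_cont_on_dominated[OF assms, of 1]) auto

text \<open>The definition is tested on a single interval, the one between the two points.\<close>

lemma abs_cont_on_imp_continuous_on: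
  assumes "abs_cont_on f a b"
  shows "continuous_on {a..b} f"
  unfolding continuous_on_iff
proof (intro ballI allI impI)
  fix u \<epsilon> :: real assume u: "u \<in> {a..b}" and "\<epsilon> > 0"
  obtain \<delta> where \<delta>: "\<delta> > 0"
    "\<And>D. \<lbrakk>D division_of \<Union>D; \<Union>D \<subseteq> {a..b}; (\<Sum>K\<in>D. Sup K - Inf K) < \<delta>\<rbrakk>
      \<Longrightarrow> (\<Sum>K\<in>D. \<bar>f (Sup K) - f (Inf K)\<bar>) < \<epsilon>"
    by (rule abs_cont_onD[OF assms \<open>\<epsilon> > 0\<close>]) (erule that, blast)
  show "\<exists>d>0. \<forall>v\<in>{a..b}. dist v u < d \<longrightarrow> dist (f v) (f u) < \<epsilon>"
  proof (intro exI conjI ballI impI)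
    fix v assume v: "v \<in> {a..b}" "dist v u < \<delta>"
    define K where "K = {min u v..max u v}"
    have K: "Sup K = max u v" "Inf K = min u v" "K \<subseteq> {a..b}"
      using u v by (auto simp: K_def)
    have "{K} division_of \<Union>{K}"
      unfolding K_def by (metis division_of_self box_real(2) Union_insert Union_empty Un_empty_right
        atLeastatMost_empty_iff min.cobounded1 max.cobounded1 order_trans)
    then have "\<bar>f (max u v) - f (min u v)\<bar> < \<epsilon>"
      using \<delta>(2)[of "{K}"] K v by (auto simp: dist_real_def)
    then show "dist (f v) (f u) < \<epsilon>"
      by (auto simp: dist_real_def max_def min_def split: if_splits)
  qed (rule \<delta>(1))
qed

lemma abs_cont_on_bounded:
  assumes "abs_cont_on f a b"
  obtains B where "B \<ge> 0" "\<And>t. t \<in> {a..b} \<Longrightarrow> \<bar>f t\<bar> \<le> B"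
proof -
  have "bounded (f ` {a..b})"
    using assms by (intro compact_imp_bounded compact_continuous_image abs_cont_on_imp_continuous_on) auto
  then obtain B where "B > 0" "\<forall>y\<in>f ` {a..b}. norm y \<le> B"
    unfolding bounded_pos by metis
  then show thesis
    using that[of B] by auto
qed

text \<open>Both factors are bounded on the compact interval, and splitting the increment of the
  product as \<open>(f v - f u) * g v + f u * (g v - g u)\<close> dominates it by the increments of
  the factors.\<close>

lemma abs_cont_on_mult:
  assumes f: "abs_cont_on f a b" and g: "abs_cont_on g a b"
  shows "abs_cont_on (\<lambda>t. f t * g t) a b"
proof -
  obtain A where A: "A \<ge> 0" "\<And>t. t \<in> {a..b} \<Longrightarrow> \<bar>f t\<bar> \<le> A"
    using abs_cont_on_bounded[OF f] by metis
  obtain B where B: "B \<ge> 0" "\<And>t. t \<in> {a..b} \<Longrightarrow> \<bar>g t\<bar> \<le> B"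
    using abs_cont_on_bounded[OF g] by metis
  show ?thesis
  proof (rule abs_cont_on_dominated[OF f g, of "max A B"])
    fix u v assume uv: "u \<in> {a..b}" "v \<in> {a..b}"
    have "f v * g v - f u * g u = (f v - f u) * g v + f u * (g v - g u)"
      by (simp add: algebra_simps)
    then have "\<bar>f v * g v - f u * g u\<bar> \<le> \<bar>f v - f u\<bar> * \<bar>g v\<bar> + \<bar>f u\<bar> * \<bar>g v - g u\<bar>"
      by (metis abs_triangle_ineq abs_mult)
    also have "\<dots> \<le> \<bar>f v - f u\<bar> * max A B + max A B * \<bar>g v - g u\<bar>"
      using A(2)[OF uv(1)] B(2)[OF uv(2)]
      by (intro add_mono mult_left_mono mult_right_mono) auto
    finally show "\<bar>f v * g v - f u * g u\<bar> \<le> max A B * (\<bar>f v - f u\<bar> + \<bar>g v - g u\<bar>)"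
      by (simp add: algebra_simps)
  qed (use A in auto)
qed

section \<open>Fundamental theorem of calculus for absolutely continuous functions\<close>

text \<open>
  Off the null set E the gauge is the one of the classical fundamental theorem. On E it is an open
  superset of E of small measure: the intervals tagged in E then have small total length, and
  absolute continuity makes their contribution to F b - F a small.
\<close>

lemma has_integral_abs_cont_on:
  fixes F f :: "real \<Rightarrow> real"
  assumes ab: "a \<le> b" and ac: "abs_cont_on F a b" and E: "negligible E"
    and deriv: "\<And>t. t \<in> {a..b} - E \<Longrightarrow> (F has_real_derivative f t) (at t within {a..b})"
  shows "(f has_integral F b - F a) {a..b}"
proof -
  \<comment> \<open>With \<open>f\<close> replaced by 0 on the null set, an interval tagged in
    \<open>E\<close> contributes only its increment of \<open>F\<close> to the error; a spike
    argument returns to \<open>f\<close> at the end.\<close>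
  define g where "g t = (if t \<in> E then 0 else f t)" for t
  have "(g has_integral F b - F a) {a..b}"
    unfolding has_integral_real
  proof (intro allI impI)
    fix e :: real assume "e > 0"
    \<comment> \<open>Intervals tagged outside \<open>E\<close> will contribute at most
      \<open>\<eta> * (b - a)\<close>, which is at most \<open>e / 2\<close>; the added 1 avoids
      division by 0 when \<open>a = b\<close>.\<close>
    define \<eta> where "\<eta> = e / (2 * (b - a + 1))"
    have "\<eta> > 0" using \<open>e > 0\<close> ab by (simp add: \<eta>_def)
    \<comment> \<open>A gauge needs a positive radius at every point, so the derivative estimate is
      put under an implication; where that is vacuous, the radius 1 does.\<close>
    have "\<forall>t. \<exists>d>0. t \<in> {a..b} - E \<longrightarrow>
        (\<forall>y\<in>{a..b}. \<bar>y - t\<bar> < d \<longrightarrow> \<bar>F y - F t - f t * (y - t)\<bar> \<le> \<eta> * \<bar>y - t\<bar>)"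
      using deriv \<open>\<eta> > 0\<close> zero_less_one
      unfolding has_field_derivative_def has_derivative_within_alt real_norm_def by blast
    then obtain d where d: "\<And>t. d t > 0"
      "\<And>t y. \<lbrakk>t \<in> {a..b} - E; y \<in> {a..b}; \<bar>y - t\<bar> < d t\<rbrakk>
          \<Longrightarrow> \<bar>F y - F t - f t * (y - t)\<bar> \<le> \<eta> * \<bar>y - t\<bar>"
      by metis
    obtain \<delta> where \<delta>: "\<delta> > 0"
      "\<And>D. \<lbrakk>D division_of \<Union>D; \<Union>D \<subseteq> {a..b}; (\<Sum>K\<in>D. Sup K - Inf K) < \<delta>\<rbrakk>
        \<Longrightarrow> (\<Sum>K\<in>D. \<bar>F (Sup K) - F (Inf K)\<bar>) < e / 2"
      by (rule abs_cont_onD[OF ac half_gt_zero[OF \<open>e > 0\<close>]]) (erule that, blast)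
    \<comment> \<open>Outer regularity: as \<open>E\<close> is null, an open superset exceeding it
      by less than \<open>\<delta>\<close> itself has measure below \<open>\<delta>\<close>.\<close>
    obtain U where U: "open U" "E \<subseteq> U" "U \<in> lmeasurable" "measure lebesgue U < \<delta>"
    proof -
      have "E \<in> sets lebesgue" "E \<in> lmeasurable"
        using E negligible_imp_measurable by (auto simp: negligible_iff_null_sets)
      obtain T where T: "open T" "E \<subseteq> T" "T - E \<in> lmeasurable" "emeasure lebesgue (T - E) < ennreal \<delta>"
        using sets_lebesgue_outer_open[OF \<open>E \<in> sets lebesgue\<close> \<delta>(1)] by metis
      have "T \<in> lmeasurable"
        using T(3) \<open>E \<in> lmeasurable\<close> \<open>E \<subseteq> T\<close> fmeasurable.Un[of "T - E" lebesgue E]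
        by (simp add: Un_absorb2)
      moreover have "measure lebesgue T = measure lebesgue (T - E)"
        using E by (metis measure_Diff_null_set negligible_iff_null_sets \<open>T \<in> lmeasurable\<close> fmeasurableD)
      moreover have "measure lebesgue (T - E) < \<delta>"
        using T(3,4) \<delta>(1) by (simp add: emeasure_eq_measure2 ennreal_less_iff)
      ultimately show thesis
        using that T(1,2) by simp
    qed
    define \<gamma> where "\<gamma> t = (if t \<in> E then U else ball t (d t))" for t
    show "\<exists>\<gamma>. gauge \<gamma> \<and> (\<forall>\<D>. \<D> tagged_division_of {a..b} \<and> \<gamma> fine \<D> \<longrightarrow>
       norm ((\<Sum>(t, K)\<in>\<D>. measure lborel K *\<^sub>R g t) - (F b - F a)) < e)"
    proof (intro exI conjI allI impI; (elim conjE)?)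
      show "gauge \<gamma>"
        using U d(1) by (auto simp: gauge_def \<gamma>_def)
      fix p assume p: "p tagged_division_of {a..b}" and fine: "\<gamma> fine p"
      have fin: "finite p" using p by auto
      have iv: "K \<subseteq> {a..b} \<and> t \<in> K \<and> Inf K \<le> Sup K
          \<and> measure lborel K = Sup K - Inf K \<and> measure lebesgue K = Sup K - Inf K"
        if tK: "(t, K) \<in> p" for t K
      proof -
        obtain u v where "K = {u..v}" and *: "t \<in> K" "K \<subseteq> {a..b}"
          using tagged_division_ofD(2-4)[OF p tK] by (metis box_real(2))
        then show ?thesis
          by auto
      qed
      define p1 where "p1 = {z\<in>p. fst z \<in> E}"
      have p1: "p1 \<subseteq> p" and fin1: "finite p1" using fin by (auto simp: p1_def)
      have td: "p1 tagged_division_of \<Union>(snd ` p1)"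
        using p p1 by (meson tagged_division_of_def tagged_partial_division_of_Union_self
            tagged_partial_division_subset)
      define D where "D = snd ` p1"
      have D: "D division_of \<Union>D"
        using division_of_tagged_division[OF td] by (simp add: D_def)
      have "(\<Sum>K\<in>D. Sup K - Inf K) = (\<Sum>K\<in>D. measure lebesgue K)"
        using p1 iv by (intro sum.cong) (auto simp: D_def)
      also have "\<dots> = measure lebesgue (\<Union>D)"
        by (rule content_division[OF D])
      also have "\<dots> \<le> measure lebesgue U"
      proof (rule measure_mono_fmeasurable)
        show "\<Union>D \<subseteq> U"
          using fine by (fastforce simp: D_def p1_def fine_def \<gamma>_def)
      qed (use U D in \<open>auto simp: fmeasurableD lmeasurable_division\<close>)
      also have "\<dots> < \<delta>" by (rule U)
      finally have "(\<Sum>K\<in>D. \<bar>F (Sup K) - F (Inf K)\<bar>) < e / 2"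
        using p1 iv by (intro \<delta>(2)[OF D]) (force simp: D_def)+
      moreover have "(\<Sum>(t, K)\<in>p1. \<bar>F (Sup K) - F (Inf K)\<bar>) = (\<Sum>K\<in>D. \<bar>F (Sup K) - F (Inf K)\<bar>)"
      proof -
        \<comment> \<open>Several tags may share a degenerate interval, so replacing pairs by
          intervals needs a summand that vanishes on every box with empty interior. One-point
          intervals give increment 0; the value at the empty set is set to 0, as \<open>Sup\<close>
          and \<open>Inf\<close> say nothing there.\<close>
        define c where "c K = (if K = {} then 0 else \<bar>F (Sup K) - F (Inf K)\<bar>)" for K
        have ne: "K \<noteq> {}" if "(t, K) \<in> p1" for t K
          using iv p1 that by blast
        have "(\<Sum>(t, K)\<in>p1. c K) = sum c D"
          unfolding D_def by (rule sum.over_tagged_division_lemma[OF td]) (auto simp: c_def)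
        moreover have "(\<Sum>(t, K)\<in>p1. c K) = (\<Sum>(t, K)\<in>p1. \<bar>F (Sup K) - F (Inf K)\<bar>)"
          using ne by (intro sum.cong) (auto simp: c_def)
        moreover have "sum c D = (\<Sum>K\<in>D. \<bar>F (Sup K) - F (Inf K)\<bar>)"
          using ne by (intro sum.cong) (auto simp: c_def D_def)
        ultimately show ?thesis by simp
      qed
      ultimately have s1: "(\<Sum>(t, K)\<in>p1. \<bar>F (Sup K) - F (Inf K)\<bar>) < e / 2" by simp
      have s2: "(\<Sum>(t, K)\<in>p - p1. \<bar>measure lborel K * g t - (F (Sup K) - F (Inf K))\<bar>)
          \<le> (\<Sum>(t, K)\<in>p - p1. \<eta> * (Sup K - Inf K))"
      proof (rule sum_mono, clarify)
        fix t K assume tK: "(t, K) \<in> p" "(t, K) \<notin> p1"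
        then have "t \<notin> E" by (auto simp: p1_def)
        define u v where "u = Inf K" and "v = Sup K"
        have K: "K \<in> snd ` p" using tK(1) by force
        then have uv: "K = {u..v}"
          using division_of_real_Sup_Inf(4)[OF division_of_tagged_division[OF p]]
          by (auto simp: u_def v_def)
        have "K \<subseteq> {a..b}" "t \<in> K" "measure lborel K = v - u"
          using iv[OF tK(1)] by (auto simp: u_def v_def)
        with uv have uv: "u \<le> t" "t \<le> v" "K = {u..v}" "K \<subseteq> {a..b}" "measure lborel K = v - u"
          by auto
        have "K \<subseteq> \<gamma> t"
          using fine tK(1) by (auto simp: fine_def)
        then have sub: "K \<subseteq> ball t (d t)"
          using \<open>t \<notin> E\<close> by (simp add: \<gamma>_def)
        have "u \<in> K" "v \<in> K" using uv by auto
        then have "u \<in> ball t (d t)" "v \<in> ball t (d t)" using sub by blast+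
        moreover have "u \<in> {a..b}" "v \<in> {a..b}" "t \<in> {a..b} - E"
          using uv \<open>t \<notin> E\<close> by auto
        ultimately have *: "\<bar>u - t\<bar> < d t" "\<bar>v - t\<bar> < d t" "u \<in> {a..b}" "v \<in> {a..b}" "t \<in> {a..b} - E"
          by (auto simp: dist_real_def)
        \<comment> \<open>The tag lies between the endpoints, so the two one-sided errors
          \<open>\<eta> * (t - u)\<close> and \<open>\<eta> * (v - t)\<close> add up to
          \<open>\<eta> * (v - u)\<close>.\<close>
        have "\<bar>F u - F t - f t * (u - t)\<bar> \<le> \<eta> * (t - u)" "\<bar>F v - F t - f t * (v - t)\<bar> \<le> \<eta> * (v - t)"
          using d(2)[of t u] d(2)[of t v] * uv(1,2) by auto
        then have "\<bar>(v - u) * f t - (F v - F u)\<bar> \<le> \<eta> * (v - u)"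
          unfolding right_diff_distrib left_diff_distrib by (simp add: abs_le_iff mult.commute)
        then show "\<bar>measure lborel K * g t - (F (Sup K) - F (Inf K))\<bar> \<le> \<eta> * (Sup K - Inf K)"
          using \<open>t \<notin> E\<close> uv by (simp add: g_def flip: u_def v_def)
      qed
      also have "\<dots> \<le> (\<Sum>(t, K)\<in>p. \<eta> * (Sup K - Inf K))"
        using iv \<open>\<eta> > 0\<close> fin p1 by (intro sum_mono2) (auto)
      also have "\<dots> = \<eta> * (b - a)"
        using additive_tagged_division_1[OF ab p, of "\<lambda>t. t"]
        by (simp add: case_prod_unfold flip: sum_distrib_left)
      also have "\<dots> \<le> e / 2"
        using \<open>e > 0\<close> ab by (simp add: \<eta>_def field_simps)
      finally have s2: "(\<Sum>(t, K)\<in>p - p1. \<bar>measure lborel K * g t - (F (Sup K) - F (Inf K))\<bar>) \<le> e / 2" .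
      \<comment> \<open>The increments of \<open>F\<close> telescope over a tagged division, so the
        error of the Riemann sum splits into one term per interval.\<close>
      have "(\<Sum>(t, K)\<in>p. measure lborel K *\<^sub>R g t) - (F b - F a)
          = (\<Sum>(t, K)\<in>p. measure lborel K * g t - (F (Sup K) - F (Inf K)))"
        using additive_tagged_division_1[OF ab p, of F]
        by (simp add: case_prod_unfold sum_subtractf)
      also have "\<bar>\<dots>\<bar> \<le> (\<Sum>(t, K)\<in>p. \<bar>measure lborel K * g t - (F (Sup K) - F (Inf K))\<bar>)"
        by (simp add: case_prod_unfold sum_abs)
      also have "\<dots> = (\<Sum>(t, K)\<in>p - p1. \<bar>measure lborel K * g t - (F (Sup K) - F (Inf K))\<bar>)
          + (\<Sum>(t, K)\<in>p1. \<bar>measure lborel K * g t - (F (Sup K) - F (Inf K))\<bar>)"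
        by (rule sum.subset_diff[OF p1 fin])
      also have "(\<Sum>(t, K)\<in>p1. \<bar>measure lborel K * g t - (F (Sup K) - F (Inf K))\<bar>)
          = (\<Sum>(t, K)\<in>p1. \<bar>F (Sup K) - F (Inf K)\<bar>)"
        by (intro sum.cong) (auto simp: p1_def g_def)
      finally show "norm ((\<Sum>(t, K)\<in>p. measure lborel K *\<^sub>R g t) - (F b - F a)) < e"
        using s1 s2 by simp
    qed
  qed
  then show ?thesis
    by (rule has_integral_spike[OF E, rotated]) (auto simp: g_def)
qed

section \<open>Cauchy-Schwarz inequality, variance and covariance on an interval\<close>

text \<open>The integral of \<open>(r * u t - s * v t)\<^sup>2\<close> is a nonnegative quadratic
  form in \<open>r\<close> and \<open>s\<close>; suitable values of these give
  \<open>C\<^sup>2 \<le> A * B\<close>.\<close>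

lemma Cauchy_Schwarz_has_integral:
  fixes u v :: "real \<Rightarrow> real"
  assumes uu: "((\<lambda>t. (u t)\<^sup>2) has_integral A) S" and vv: "((\<lambda>t. (v t)\<^sup>2) has_integral B) S"
    and uv: "((\<lambda>t. u t * v t) has_integral C) S"
  shows "\<bar>C\<bar> \<le> sqrt A * sqrt B"
proof -
  have A: "A \<ge> 0" and B: "B \<ge> 0"
    using has_integral_nonneg[OF uu] has_integral_nonneg[OF vv] by auto
  have q: "r\<^sup>2 * A - 2 * r * s * C + s\<^sup>2 * B \<ge> 0" for r s
  proof -
    have "((\<lambda>t. r\<^sup>2 * (u t)\<^sup>2 - 2 * r * s * (u t * v t) + s\<^sup>2 * (v t)\<^sup>2)
        has_integral r\<^sup>2 * A - 2 * r * s * C + s\<^sup>2 * B) S"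
      by (intro has_integral_add has_integral_diff has_integral_mult_right uu vv uv)
    moreover have "r\<^sup>2 * (u t)\<^sup>2 - 2 * r * s * (u t * v t) + s\<^sup>2 * (v t)\<^sup>2 = (r * u t - s * v t)\<^sup>2" for t
      by (simp add: power2_eq_square algebra_simps)
    ultimately show ?thesis
      by (metis (no_types, lifting) has_integral_nonneg zero_le_power2)
  qed
  have "C\<^sup>2 \<le> A * B"
  proof (cases "B = 0")
    case True
    show ?thesis
    proof (cases "C = 0")
      case False
      \<comment> \<open>For \<open>B = 0\<close> and \<open>r = 1\<close> the form is
        \<open>A - 2 * s * C\<close>; the chosen \<open>s\<close> makes it -1, a
        contradiction.\<close>
      with True q[of 1 "(A + 1) / (2 * C)"] show ?thesis by simp
    qed (use True in simp)
  next
    case False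
    \<comment> \<open>At \<open>r = B\<close> and \<open>s = C\<close> the form factors in this
      way.\<close>
    have "B * (A * B - C\<^sup>2) \<ge> 0"
      using q[of B C] by (simp add: power2_eq_square algebra_simps)
    then show ?thesis
      using False B by (simp add: zero_le_mult_iff)
  qed
  then show ?thesis
    by (metis real_sqrt_abs real_sqrt_le_mono real_sqrt_mult)
qed

text \<open>Expanding the square about the mean \<open>W / (b - a)\<close> gives the variance
  formula, mean of the square minus square of the mean, scaled by the length
  \<open>b - a\<close>.\<close>

lemma has_integral_variance:
  fixes w :: "real \<Rightarrow> real"
  assumes ab: "a < b" and w: "(w has_integral W) {a..b}" and ww: "((\<lambda>t. (w t)\<^sup>2) has_integral WW) {a..b}"
  shows "((\<lambda>t. (w t - W / (b - a))\<^sup>2) has_integral (b - a) * (WW / (b - a) - (W / (b - a))\<^sup>2)) {a..b}"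
proof -
  define r where "r = W / (b - a)"
  have W: "W = r * (b - a)" using ab by (simp add: r_def)
  have "((\<lambda>t. (w t)\<^sup>2 - 2 * r * w t + r\<^sup>2) has_integral WW - 2 * r * W + r\<^sup>2 * (b - a)) {a..b}"
    using has_integral_const_real[of "r\<^sup>2" a b] ab
    by (intro has_integral_add has_integral_diff has_integral_mult_right w ww) (simp add: mult.commute)
  moreover have "(b - a) * (WW / (b - a) - r\<^sup>2) = WW - (b - a) * r\<^sup>2"
    using ab by (simp add: right_diff_distrib)
  then have "WW - 2 * r * W + r\<^sup>2 * (b - a) = (b - a) * (WW / (b - a) - r\<^sup>2)"
    by (simp add: W power2_eq_square algebra_simps)
  moreover have "(w t)\<^sup>2 - 2 * r * w t + r\<^sup>2 = (w t - r)\<^sup>2" for t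
    by (simp add: power2_eq_square algebra_simps)
  ultimately show ?thesis by (simp add: r_def)
qed

text \<open>The variance comes from integrating a square. In HOL \<open>sqrt\<close> of a negative
  number is negative, so a standard deviation is seen to be nonnegative only through its
  radicand.\<close>

lemma variance_has_integral_nonneg:
  fixes w :: "real \<Rightarrow> real"
  assumes ab: "a < b" and "(w has_integral W) {a..b}" "((\<lambda>t. (w t)\<^sup>2) has_integral WW) {a..b}"
  shows "0 \<le> WW / (b - a) - (W / (b - a))\<^sup>2"
proof -
  have "0 \<le> (b - a) * (WW / (b - a) - (W / (b - a))\<^sup>2)"
    using has_integral_nonneg[OF has_integral_variance[OF assms]] by simp
  then show ?thesis using ab by (simp add: zero_le_mult_iff)
qed

text \<open>The left side is the integral of the product of the deviations of \<open>u\<close> and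
  \<open>v\<close> from their means. Cauchy-Schwarz gives two factors \<open>sqrt (b - a)\<close>,
  which merge into \<open>b - a\<close>.\<close>

lemma Chebyshev_functional_le:
  fixes u v :: "real \<Rightarrow> real"
  assumes ab: "a < b"
    and u: "(u has_integral U) {a..b}" and v: "(v has_integral V) {a..b}"
    and uu: "((\<lambda>t. (u t)\<^sup>2) has_integral UU) {a..b}" and vv: "((\<lambda>t. (v t)\<^sup>2) has_integral VV) {a..b}"
    and uv: "((\<lambda>t. u t * v t) has_integral UV) {a..b}"
  shows "\<bar>UV - U * V / (b - a)\<bar>
    \<le> (b - a) * sqrt (UU / (b - a) - (U / (b - a))\<^sup>2) * sqrt (VV / (b - a) - (V / (b - a))\<^sup>2)"
proof -
  have c: "((\<lambda>t. c) has_integral c * (b - a)) {a..b}" for c :: real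
    using has_integral_const_real[of c a b] ab by (simp add: mult.commute)
  define m n where "m = U / (b - a)" and "n = V / (b - a)"
  have mn: "U = m * (b - a)" "V = n * (b - a)"
    using ab by (auto simp: m_def n_def)
  have "((\<lambda>t. u t * v t - n * u t - m * v t + m * n)
      has_integral UV - n * (m * (b - a)) - m * (n * (b - a)) + m * n * (b - a)) {a..b}"
    using u v unfolding mn by (intro has_integral_add has_integral_diff has_integral_mult_right uv c)
  moreover have "UV - n * (m * (b - a)) - m * (n * (b - a)) + m * n * (b - a) = UV - U * V / (b - a)"
    using ab by (simp add: mn)
  moreover have "u t * v t - n * u t - m * v t + m * n = (u t - m) * (v t - n)" for t
    by (simp add: algebra_simps)
  ultimately have "((\<lambda>t. (u t - m) * (v t - n)) has_integral UV - U * V / (b - a)) {a..b}"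
    by simp
  with has_integral_variance[OF ab u uu] has_integral_variance[OF ab v vv]
  have "\<bar>UV - U * V / (b - a)\<bar>
      \<le> sqrt ((b - a) * (UU / (b - a) - m\<^sup>2)) * sqrt ((b - a) * (VV / (b - a) - n\<^sup>2))"
    unfolding m_def n_def by (rule Cauchy_Schwarz_has_integral)
  also have "\<dots> = (b - a) * sqrt (UU / (b - a) - m\<^sup>2) * sqrt (VV / (b - a) - n\<^sup>2)"
    using ab by (simp add: real_sqrt_mult)
  finally show ?thesis by (simp add: m_def n_def)
qed

text \<open>Integrating \<open>(u t - l) * (r - u t) \<ge> 0\<close> bounds the variance by
  \<open>(m - l) * (r - m)\<close>, with \<open>m\<close> the mean, and this is largest when
  \<open>m\<close> is the midpoint of \<open>l\<close> and \<open>r\<close>.\<close>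

lemma Popoviciu_has_integral:
  fixes u :: "real \<Rightarrow> real"
  assumes ab: "a < b" and u: "(u has_integral U) {a..b}"
    and uu: "((\<lambda>t. (u t)\<^sup>2) has_integral UU) {a..b}"
    and bounds: "\<And>t. t \<in> {a..b} \<Longrightarrow> l \<le> u t \<and> u t \<le> r"
  shows "sqrt (UU / (b - a) - (U / (b - a))\<^sup>2) \<le> (r - l) / 2"
proof -
  define m where "m = U / (b - a)"
  have "((\<lambda>t. (l + r) * u t - l * r) has_integral (l + r) * U - l * r * (b - a)) {a..b}"
    using has_integral_const_real[of "l * r" a b] ab
    by (intro has_integral_diff has_integral_mult_right u) (simp add: mult.commute)
  then have "UU \<le> (l + r) * U - l * r * (b - a)"
  proof (rule has_integral_le[OF uu])
    fix t assume "t \<in> {a..b}"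
    then have "0 \<le> (u t - l) * (r - u t)" using bounds[of t] by simp
    then show "(u t)\<^sup>2 \<le> (l + r) * u t - l * r" by (simp add: power2_eq_square algebra_simps)
  qed
  then have "UU / (b - a) \<le> ((l + r) * U - l * r * (b - a)) / (b - a)"
    using ab by (intro divide_right_mono) auto
  also have "\<dots> = (l + r) * m - l * r"
    using ab by (simp add: m_def diff_divide_distrib)
  \<comment> \<open>Completing the square in \<open>m\<close>; the last square is then
    dropped.\<close>
  also have "(l + r) * m - l * r = m\<^sup>2 + ((r - l) / 2)\<^sup>2 - (m - (l + r) / 2)\<^sup>2"
    by (simp add: power2_eq_square field_simps)
  finally have "UU / (b - a) - m\<^sup>2 \<le> ((r - l) / 2)\<^sup>2"
    using zero_le_power2[of "m - (l + r) / 2"] by linarith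
  then show ?thesis
    using bounds[of a] ab by (intro real_le_lsqrt) (auto simp: m_def)
qed

section \<open>Integrals of piecewise functions, of powers and of a weighted second
  derivative\<close>

lemma has_integral_If_le:
  fixes u v :: "real \<Rightarrow> real"
  assumes "a \<le> x" "x \<le> b" and u: "(u has_integral I) {a..x}" and v: "(v has_integral J) {x..b}"
  shows "((\<lambda>t. if t \<le> x then u t else v t) has_integral I + J) {a..b}"
proof (rule has_integral_combine[OF assms(1,2)])
  show "((\<lambda>t. if t \<le> x then u t else v t) has_integral I) {a..x}"
    using u by (rule has_integral_eq[rotated]) auto
  show "((\<lambda>t. if t \<le> x then u t else v t) has_integral J) {x..b}"
    \<comment> \<open>At \<open>x\<close> the case distinction takes the value of \<open>u\<close>,
      so on the right half agreement with \<open>v\<close> is assured only off that one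
      point.\<close>
    by (rule has_integral_spike_finite[of "{x}", OF _ _ v]) auto
qed

lemma has_integral_shifted_power:
  fixes p q c :: real
  assumes "p \<le> q"
  shows "((\<lambda>t. (t - c) ^ n) has_integral ((q - c) ^ Suc n - (p - c) ^ Suc n) / real (Suc n)) {p..q}"
proof -
  have "((\<lambda>t. (t - c) ^ n) has_integral (q - c) ^ Suc n / real (Suc n) - (p - c) ^ Suc n / real (Suc n)) {p..q}"
  proof (rule fundamental_theorem_of_calculus[OF assms])
    fix t
    have "((\<lambda>t. (t - c) ^ Suc n / real (Suc n)) has_real_derivative (t - c) ^ n) (at t within {p..q})"
      by (rule derivative_eq_intros refl | simp)+
    then show "((\<lambda>t. (t - c) ^ Suc n / real (Suc n)) has_vector_derivative (t - c) ^ n) (at t within {p..q})"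
      by (simp add: has_real_derivative_iff_has_vector_derivative)
  qed
  then show ?thesis by (simp add: diff_divide_distrib)
qed

text \<open>Two integrations by parts in one: off \<open>E\<close> the derivative of
  \<open>G\<close> is \<open>(t - c)\<^sup>2 / 2 * f'' t - f t\<close>, and \<open>G\<close> is
  absolutely continuous, so the fundamental theorem above applies.\<close>

lemma has_integral_square_mult_second_deriv:
  fixes f f' f'' :: "real \<Rightarrow> real" and p q c :: real
  defines "G \<equiv> \<lambda>t. (t - c)\<^sup>2 / 2 * f' t - (t - c) * f t"
  assumes pq: "p \<le> q" and f: "abs_cont_on f p q" and f': "abs_cont_on f' p q"
    and df: "\<And>t. t \<in> {p..q} \<Longrightarrow> (f has_real_derivative f' t) (at t within {p..q})"
    and E: "negligible E"
    and df': "\<And>t. t \<in> {p..q} - E \<Longrightarrow> (f' has_real_derivative f'' t) (at t within {p..q})"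
  shows "((\<lambda>t. (t - c)\<^sup>2 / 2 * f'' t) has_integral G q - G p + integral {p..q} f) {p..q}"
proof -
  \<comment> \<open>This form uses only products and differences, for which absolute continuity is
    known.\<close>
  have G: "G = (\<lambda>t. (t - c) * ((t - c) * (1 / 2 * f' t) - f t))"
    by (simp add: G_def fun_eq_iff power2_eq_square algebra_simps)
  have ac: "abs_cont_on G p q"
    unfolding G
    by (intro abs_cont_on_mult abs_cont_on_diff abs_cont_on_ident abs_cont_on_const f f')
  have deriv: "(G has_real_derivative (t - c)\<^sup>2 / 2 * f'' t - f t) (at t within {p..q})"
    if "t \<in> {p..q} - E" for t
    unfolding G
    by (rule derivative_eq_intros refl df df' that DiffD1[OF that])+
      (simp add: power2_eq_square algebra_simps)
  have "((\<lambda>t. (t - c)\<^sup>2 / 2 * f'' t - f t) has_integral G q - G p) {p..q}"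
    by (rule has_integral_abs_cont_on[OF pq ac E deriv])
  moreover have "(f has_integral integral {p..q} f) {p..q}"
    using abs_cont_on_imp_continuous_on[OF f] by (intro integrable_integral integrable_continuous_real)
  ultimately have "((\<lambda>t. (t - c)\<^sup>2 / 2 * f'' t - f t + f t) has_integral G q - G p + integral {p..q} f) {p..q}"
    by (rule has_integral_add)
  then show ?thesis by simp
qed

section \<open>Kernel representation of \<open>\<tau>\<close> and the two estimates\<close>

theorem theorem3:
  fixes f f' f'' :: "real \<Rightarrow> real" and a b h x \<alpha> \<beta> \<kappa> \<Phi> \<phi> lam :: real
  assumes "a < b"
    and "h \<in> {0..1}"
    and "x \<in> {a + h * ((b - a) / 2)..b - h * ((b - a) / 2)}"
    and "\<alpha> \<ge> 0" and "\<beta> \<ge> 0" and "\<not> (\<alpha> = 0 \<and> \<beta> = 0)"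
    and "abs_cont_on f a b"
    and "\<And>t. t \<in> {a..b} \<Longrightarrow> (f has_real_derivative f' t) (at t within {a..b})"
    and "abs_cont_on f' a b"
    and "AE t in lebesgue. t \<in> {a..b} \<longrightarrow> (f' has_real_derivative f'' t) (at t within {a..b})"
    and "(\<lambda>t. \<bar>f'' t\<bar>\<^sup>2) absolutely_integrable_on {a..b}"
    and "\<kappa> = (f' b - f' a) / (b - a)"
    and "\<Phi> = (SUP t\<in>{a..b}. P a b h \<alpha> \<beta> x t)"
    and "\<phi> = (INF t\<in>{a..b}. P a b h \<alpha> \<beta> x t)"
    and "lam = \<Phi> - \<phi>"
  shows "\<bar>\<tau> f f' a b h x \<alpha> \<beta> - 1 / (\<alpha> + \<beta>) * cubic_bracket a b h x \<alpha> \<beta> * (\<kappa> / 6)\<bar>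
           \<le> (b - a) * N a b h x \<alpha> \<beta> * sqrt (1 / (b - a) * (norm2 f'' a b)\<^sup>2 - \<kappa>\<^sup>2)
       \<and> (\<forall>\<gamma> \<Gamma>. (\<forall>t\<in>{a..b}. \<gamma> \<le> f'' t \<and> f'' t \<le> \<Gamma>) \<longrightarrow>
           (b - a) * N a b h x \<alpha> \<beta> * sqrt (1 / (b - a) * (norm2 f'' a b)\<^sup>2 - \<kappa>\<^sup>2)
             \<le> (b - a) * (\<Gamma> - \<gamma>) * lam)"
proof -
  note ab = \<open>a < b\<close>
  \<comment> \<open>Division by zero yields \<open>p = 0\<close> if \<open>x = a\<close> and
    \<open>q = 0\<close> if \<open>x = b\<close>. The identities below are in terms of
    \<open>A\<close>, \<open>p\<close>, \<open>q\<close> and \<open>s\<close>, and so cover these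
    cases without a case distinction.\<close>
  define s A p q where "s = h * ((b - a) / 2)" and "A = 1 / (\<alpha> + \<beta>)"
    and "p = \<alpha> / (x - a)" and "q = \<beta> / (b - x)"
  have "s \<ge> 0" using ab \<open>h \<in> {0..1}\<close> by (simp add: s_def)
  then have ax: "a \<le> x" and xb: "x \<le> b"
    using \<open>x \<in> _\<close> unfolding s_def[symmetric] by auto
  define k where "k = P a b h \<alpha> \<beta> x"
  have k: "k = (\<lambda>t. if t \<le> x then A * p / 2 * (t - (a + s))\<^sup>2 else A * q / 2 * (t - (b - s))\<^sup>2)"
    unfolding k_def P_def s_def[symmetric] by (simp add: fun_eq_iff A_def p_def q_def)
  have cub: "cubic_bracket a b h x \<alpha> \<beta> = p * ((x - (a + s)) ^ 3 + s ^ 3) - q * ((x - (b - s)) ^ 3 - s ^ 3)"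
    unfolding cubic_bracket_def s_def[symmetric] by (simp add: p_def q_def)
  \<comment> \<open>\<open>m\<close> and \<open>S\<close> will turn out to be the integrals of the
    kernel and of its square, which identifies \<open>N\<close> as the standard deviation of the
    kernel.\<close>
  define m where "m = A / 6 * cubic_bracket a b h x \<alpha> \<beta>"
  define S where "S = A\<^sup>2 / 20 * (p\<^sup>2 * ((x - (a + s)) ^ 5 + s ^ 5) + q\<^sup>2 * (s ^ 5 - (x - (b - s)) ^ 5))"
  have N: "N a b h x \<alpha> \<beta> = sqrt (S / (b - a) - (m / (b - a))\<^sup>2)"
  proof -
    have "1 / (20 * (b - a) * (\<alpha> + \<beta>)\<^sup>2) * (\<alpha>\<^sup>2 / (x - a)\<^sup>2 * u + \<beta>\<^sup>2 / (b - x)\<^sup>2 * v)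
        = A\<^sup>2 / 20 * (p\<^sup>2 * u + q\<^sup>2 * v) / (b - a)" for u v
      by (simp add: A_def p_def q_def power_divide)
    moreover have "1 / (6 * (b - a) * (\<alpha> + \<beta>)) * u = A / 6 * u / (b - a)" for u
      by (simp add: A_def) (simp add: algebra_simps)
    ultimately show ?thesis
      unfolding N_def S_def m_def by (simp only: flip: s_def)
  qed

  \<comment> \<open>Integrals of the kernel and of its square\<close>
  have int_k: "(k has_integral m) {a..b}"
  proof -
    have "(k has_integral
        A * p / 2 * (((x - (a + s)) ^ Suc 2 - (a - (a + s)) ^ Suc 2) / real (Suc 2))
        + A * q / 2 * (((b - (b - s)) ^ Suc 2 - (x - (b - s)) ^ Suc 2) / real (Suc 2))) {a..b}"
      unfolding k
      by (intro has_integral_If_le has_integral_mult_right has_integral_shifted_power ax xb)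
    also have "A * p / 2 * (((x - (a + s)) ^ Suc 2 - (a - (a + s)) ^ Suc 2) / real (Suc 2))
        + A * q / 2 * (((b - (b - s)) ^ Suc 2 - (x - (b - s)) ^ Suc 2) / real (Suc 2)) = m"
    proof -
      \<comment> \<open>Measured from the centres \<open>a + s\<close> and \<open>b - s\<close>, the
        outer endpoints are \<open>- s\<close> and \<open>s\<close>; the odd power turns the first
        lower limit into an added \<open>s ^ 3\<close>.\<close>
      have "Suc 2 = 3" "a - (a + s) = - s" "b - (b - s) = s" "(- s) ^ 3 = - (s ^ 3)" "real 3 = 3" by auto
      moreover have "A * p / 2 * ((u - - w) / 3) + A * q / 2 * ((w - v) / 3)
          = A / 6 * (p * (u + w) - q * (v - w))" for u v w
        by (simp add: field_simps)
      ultimately show ?thesis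
        unfolding m_def cub by (simp only:)
    qed
    finally show ?thesis .
  qed
  have int_kk: "((\<lambda>t. (k t)\<^sup>2) has_integral S) {a..b}"
  proof -
    have sq: "(\<lambda>t. (k t)\<^sup>2) = (\<lambda>t. if t \<le> x then (A * p / 2)\<^sup>2 * (t - (a + s)) ^ 4 else (A * q / 2)\<^sup>2 * (t - (b - s)) ^ 4)"
      by (simp add: k fun_eq_iff power_mult_distrib power_divide flip: power_mult)
    have "((\<lambda>t. (k t)\<^sup>2) has_integral
        (A * p / 2)\<^sup>2 * (((x - (a + s)) ^ Suc 4 - (a - (a + s)) ^ Suc 4) / real (Suc 4))
        + (A * q / 2)\<^sup>2 * (((b - (b - s)) ^ Suc 4 - (x - (b - s)) ^ Suc 4) / real (Suc 4))) {a..b}"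
      unfolding sq
      by (intro has_integral_If_le has_integral_mult_right has_integral_shifted_power ax xb)
    also have "(A * p / 2)\<^sup>2 * (((x - (a + s)) ^ Suc 4 - (a - (a + s)) ^ Suc 4) / real (Suc 4))
        + (A * q / 2)\<^sup>2 * (((b - (b - s)) ^ Suc 4 - (x - (b - s)) ^ Suc 4) / real (Suc 4)) = S"
    proof -
      have "Suc 4 = 5" "a - (a + s) = - s" "b - (b - s) = s" "(- s) ^ 5 = - (s ^ 5)" "real 5 = 5" by auto
      moreover have "(A * p / 2)\<^sup>2 * ((u - - w) / 5) + (A * q / 2)\<^sup>2 * ((w - v) / 5)
          = A\<^sup>2 / 20 * (p\<^sup>2 * (u + w) + q\<^sup>2 * (w - v))" for u v w
        by (simp add: field_simps power2_eq_square)
      ultimately show ?thesis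
        unfolding S_def by (simp only:)
    qed
    finally show ?thesis .
  qed

  \<comment> \<open>\<open>\<tau>\<close> as the integral of the kernel against
    \<open>f''\<close>\<close>
  obtain E where E: "negligible E"
    and df': "\<And>t. t \<in> {a..b} - E \<Longrightarrow> (f' has_real_derivative f'' t) (at t within {a..b})"
    using \<open>AE t in lebesgue. _\<close> unfolding eventually_ae_filter_negligible by blast
  have int_kf: "((\<lambda>t. k t * f'' t) has_integral \<tau> f f' a b h x \<alpha> \<beta>) {a..b}"
  proof -
    have I: "((\<lambda>t. (t - c)\<^sup>2 / 2 * f'' t) has_integral
        ((v - c)\<^sup>2 / 2 * f' v - (v - c) * f v) - ((u - c)\<^sup>2 / 2 * f' u - (u - c) * f u) + integral {u..v} f) {u..v}"
      if "u \<le> v" "{u..v} \<subseteq> {a..b}" for u v c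
    proof (rule has_integral_square_mult_second_deriv[OF that(1) _ _ _ E])
      show "abs_cont_on f u v" "abs_cont_on f' u v"
        using assms abs_cont_on_subset that(2) by metis+
      show "(f has_real_derivative f' t) (at t within {u..v})" if "t \<in> {u..v}" for t
        using assms(8) DERIV_subset that \<open>{u..v} \<subseteq> {a..b}\<close> by blast
      show "(f' has_real_derivative f'' t) (at t within {u..v})" if "t \<in> {u..v} - E" for t
        using df' DERIV_subset that \<open>{u..v} \<subseteq> {a..b}\<close> by blast
    qed
    \<comment> \<open>These are the values of \<open>I\<close> for \<open>c = a + s\<close> on
      \<open>{a..x}\<close> and for \<open>c = b - s\<close> on \<open>{x..b}\<close>.\<close>
    define J1 J2 where
      "J1 = (x - (a + s))\<^sup>2 / 2 * f' x - (x - (a + s)) * f x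
        - ((a - (a + s))\<^sup>2 / 2 * f' a - (a - (a + s)) * f a) + integral {a..x} f" and
      "J2 = (b - (b - s))\<^sup>2 / 2 * f' b - (b - (b - s)) * f b
        - ((x - (b - s))\<^sup>2 / 2 * f' x - (x - (b - s)) * f x) + integral {x..b} f"
    have kf: "(\<lambda>t. k t * f'' t) = (\<lambda>t. if t \<le> x then A * p * ((t - (a + s))\<^sup>2 / 2 * f'' t)
        else A * q * ((t - (b - s))\<^sup>2 / 2 * f'' t))"
      by (simp add: k fun_eq_iff)
    have "((\<lambda>t. k t * f'' t) has_integral A * p * J1 + A * q * J2) {a..b}"
      unfolding kf J1_def J2_def using ax xb
      by (intro has_integral_If_le has_integral_mult_right I) auto
    also have "A * p * J1 + A * q * J2
      = A / 2 * (p * (x - (a + s))\<^sup>2 - q * (x - (b - s))\<^sup>2) * f' x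
        - A * (p * (x - (a + s)) - q * (x - (b - s))) * f x
        - A * s * (p * f a + q * f b) + A * (s\<^sup>2 / 2) * (q * f' b - p * f' a)
        + A * (p * integral {a..x} f + q * integral {x..b} f)"
      by (simp add: J1_def J2_def field_simps)
    also have "\<dots> = \<tau> f f' a b h x \<alpha> \<beta>"
    proof -
      \<comment> \<open>The integral means bring their own factors \<open>1 / (x - a)\<close> and
        \<open>1 / (b - x)\<close>, which combine with \<open>\<alpha>\<close> and
        \<open>\<beta>\<close> to \<open>p\<close> and \<open>q\<close>.\<close>
      have "1 / (2 * (\<alpha> + \<beta>)) = A / 2" "A * h * ((b - a) / 2) = A * s"
        "A * h\<^sup>2 * ((b - a)\<^sup>2 / 8) = A * (s\<^sup>2 / 2)"
        "\<alpha> * int_mean f a x = p * integral {a..x} f" "\<beta> * int_mean f x b = q * integral {x..b} f"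
        by (simp_all add: A_def s_def p_def q_def int_mean_def power_mult_distrib power_divide)
      then show ?thesis
        unfolding \<tau>_def by (simp only: flip: s_def A_def p_def q_def)
    qed
    finally show ?thesis .
  qed

  \<comment> \<open>Integrals of \<open>f''\<close> and of its square\<close>
  have int_f: "(f'' has_integral \<kappa> * (b - a)) {a..b}"
    \<comment> \<open>As \<open>f'\<close> is absolutely continuous, its increment is the integral
      of \<open>f''\<close>, so \<open>\<kappa>\<close> is the mean of \<open>f''\<close>.\<close>
    using has_integral_abs_cont_on[OF less_imp_le[OF ab] assms(9) E df'] ab \<open>\<kappa> = _\<close> by simp
  have int_ff: "((\<lambda>t. (f'' t)\<^sup>2) has_integral (norm2 f'' a b)\<^sup>2) {a..b}"
  proof -
    have i: "(\<lambda>t. (f'' t)\<^sup>2) integrable_on {a..b}"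
      using set_lebesgue_integral_eq_integral(1)[OF assms(11)] by simp
    moreover have "(norm2 f'' a b)\<^sup>2 = integral {a..b} (\<lambda>t. (f'' t)\<^sup>2)"
      using integral_nonneg[OF i] by (simp add: norm2_def)
    ultimately show ?thesis by (simp add: integrable_integral)
  qed

  \<comment> \<open>The covariance estimate\<close>
  define Q where "Q = sqrt (1 / (b - a) * (norm2 f'' a b)\<^sup>2 - \<kappa>\<^sup>2)"
  \<comment> \<open>Writing \<open>\<kappa>\<close> as an integral divided by the length gives
    \<open>Q\<close> the shape of the standard deviation of \<open>f''\<close>.\<close>
  have Q: "Q = sqrt ((norm2 f'' a b)\<^sup>2 / (b - a) - (\<kappa> * (b - a) / (b - a))\<^sup>2)"
    using ab by (simp add: Q_def)
  have "\<bar>\<tau> f f' a b h x \<alpha> \<beta> - m * (\<kappa> * (b - a)) / (b - a)\<bar> \<le> (b - a) * N a b h x \<alpha> \<beta> * Q"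
    unfolding N Q by (rule Chebyshev_functional_le[OF ab int_k int_f int_kk int_ff int_kf])
  moreover have "m * (\<kappa> * (b - a)) / (b - a) = 1 / (\<alpha> + \<beta>) * cubic_bracket a b h x \<alpha> \<beta> * (\<kappa> / 6)"
    using ab by (simp add: m_def A_def)
  ultimately have first: "\<bar>\<tau> f f' a b h x \<alpha> \<beta> - 1 / (\<alpha> + \<beta>) * cubic_bracket a b h x \<alpha> \<beta> * (\<kappa> / 6)\<bar>
      \<le> (b - a) * N a b h x \<alpha> \<beta> * Q"
    by simp

  \<comment> \<open>Bounds of the kernel and the oscillation estimate\<close>
  have "bounded (k ` {a..b})"
  proof -
    \<comment> \<open>The kernel may jump at \<open>x\<close>, so boundedness is taken from its two
      continuous branches. It makes the supremum and infimum genuine bounds.\<close>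
    have "bounded ((\<lambda>t. A * p / 2 * (t - (a + s))\<^sup>2) ` {a..b})" "bounded ((\<lambda>t. A * q / 2 * (t - (b - s))\<^sup>2) ` {a..b})"
      by (intro compact_imp_bounded compact_continuous_image continuous_intros; simp)+
    then have "bounded ((\<lambda>t. A * p / 2 * (t - (a + s))\<^sup>2) ` {a..b} \<union> (\<lambda>t. A * q / 2 * (t - (b - s))\<^sup>2) ` {a..b})"
      by simp
    then show ?thesis
      by (rule bounded_subset) (auto simp: k)
  qed
  then have bdd: "bdd_above (k ` {a..b})" "bdd_below (k ` {a..b})"
    by (auto intro: bounded_imp_bdd_above bounded_imp_bdd_below)
  have k_bounds: "\<phi> \<le> k t \<and> k t \<le> \<Phi>" if "t \<in> {a..b}" for t
    using cINF_lower[OF bdd(2) that] cSUP_upper[OF that bdd(1)] assms(13,14) by (simp add: k_def)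
  have "\<phi> \<le> \<Phi>" using k_bounds[of a] ab by simp

  have "(b - a) * N a b h x \<alpha> \<beta> * Q \<le> (b - a) * (\<Gamma> - \<gamma>) * lam"
    if f_bounds: "\<forall>t\<in>{a..b}. \<gamma> \<le> f'' t \<and> f'' t \<le> \<Gamma>" for \<gamma> \<Gamma>
  proof -
    have "\<gamma> \<le> \<Gamma>" using f_bounds ab by force
    have "N a b h x \<alpha> \<beta> \<le> lam / 2"
      unfolding N \<open>lam = _\<close> by (rule Popoviciu_has_integral[OF ab int_k int_kk k_bounds])
    \<comment> \<open>The factor 1/2 is given up here and again for \<open>Q\<close>, since the
      claimed bound is four times the one from the two half oscillations.\<close>
    also have "\<dots> \<le> lam" using \<open>\<phi> \<le> \<Phi>\<close> \<open>lam = _\<close> by simp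
    finally have "N a b h x \<alpha> \<beta> \<le> lam" .
    moreover have "Q \<le> (\<Gamma> - \<gamma>) / 2"
      unfolding Q using f_bounds by (intro Popoviciu_has_integral[OF ab int_f int_ff]) auto
    then have "Q \<le> \<Gamma> - \<gamma>" using \<open>\<gamma> \<le> \<Gamma>\<close> by simp
    moreover have "Q \<ge> 0"
      unfolding Q using variance_has_integral_nonneg[OF ab int_f int_ff] by simp
    ultimately have "N a b h x \<alpha> \<beta> * Q \<le> lam * (\<Gamma> - \<gamma>)"
      using \<open>\<phi> \<le> \<Phi>\<close> \<open>lam = _\<close> by (intro mult_mono) auto
    then show ?thesis
      using ab by (simp add: mult.assoc mult.commute)
  qed
  with first show ?thesis
    unfolding Q_def by blast
qed

end
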